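(* Let $K$ be a field of characteristic $\neq 2$, and let $\mathcal Q(x,y,z)=x^2+y^2-z^2$. The orthogonal group $O_{\mathcal Q}(K[t])$ acts transitively (by matrix multiplication on column vectors) on the set of all primitive Pythagorean triples in $K[t]^3$.
   Context: $K[t]$ is the polynomial ring in one variable over $K$. $O_{\mathcal Q}(K[t])$ is the group of matrices $A\in \mathrm{GL}_3(K[t])$ with $\mathcal Q(A\mathbf x)=\mathcal Q(\mathbf x)$ for all $\mathbf x\in K[t]^3$. A Pythagorean triple is a nonzero triple $(x,y,z)\in K[t]^3$ with $x^2+y^2=z^2$; it is primitive if $\gcd(x,y,z)=1$. *)

theory Defs
  imports
    "HOL-Analysis.Analysis"
    "HOL-Algebra.Group_Action"
    "HOL-Computational_Algebra.Polynomial_Factorial"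
begin

definition quadform :: "'r::comm_ring_1 ^ 3 \<Rightarrow> 'r" where
  "quadform v = (v $ 1)\<^sup>2 + (v $ 2)\<^sup>2 - (v $ 3)\<^sup>2"

definition orthogonal_grp :: "('r::comm_ring_1 ^ 3 ^ 3) monoid" where
  "orthogonal_grp =
     \<lparr>carrier = {A. invertible A \<and> (\<forall>x. quadform (A *v x) = quadform x)},
      mult = (**), one = mat 1\<rparr>"

definition pythagorean_triple :: "'a::field poly ^ 3 \<Rightarrow> bool" where
  "pythagorean_triple v \<longleftrightarrow> v \<noteq> 0 \<and> (v $ 1)\<^sup>2 + (v $ 2)\<^sup>2 = (v $ 3)\<^sup>2"

text \<open>
  The operation \<open>gcd\<close> on \<open>'a poly\<close> is available only if \<open>'a\<close> carries additional normalization and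
  gcd structure, which an arbitrary type of class \<open>field\<close> lacks. Over such a field,
  \<open>gcd(x,y,z) = 1\<close> is therefore written out, following the library's definition of \<open>coprime\<close>.
\<close>

definition primitive :: "'a::field poly ^ 3 \<Rightarrow> bool" where
  "primitive v \<longleftrightarrow> (\<forall>d. d dvd v $ 1 \<longrightarrow> d dvd v $ 2 \<longrightarrow> d dvd v $ 3 \<longrightarrow> is_unit d)"

lemma primitive_iff_gcd:
  fixes v :: "'a::field_gcd poly ^ 3"
  shows "primitive v \<longleftrightarrow> gcd (v $ 1) (gcd (v $ 2) (v $ 3)) = 1"
proof
  assume "primitive v"
  then have "is_unit (gcd (v $ 1) (gcd (v $ 2) (v $ 3)))"
    unfolding primitive_def by (meson dvd_trans gcd_dvd1 gcd_dvd2)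
  then show "gcd (v $ 1) (gcd (v $ 2) (v $ 3)) = 1"
    by (metis is_unit_gcd_iff)
next
  assume "gcd (v $ 1) (gcd (v $ 2) (v $ 3)) = 1"
  then show "primitive v"
    unfolding primitive_def by (metis gcd_greatest)
qed

definition primitive_pythagorean_triples :: "('a::field poly ^ 3) set" where
  "primitive_pythagorean_triples = {v. pythagorean_triple v \<and> primitive v}"

end

theory Submission
  imports Defs
begin

text \<open>
  In the coordinates $u = z - x$ and $v = z + x$ a Pythagorean triple is a solution of $uv = y^2$.
  The shear $y \mapsto y + qu$, $v \mapsto v + 2qy + q^2u$ is orthogonal for every polynomial $q$.
  If $0 \neq u$ and $\deg u \le \deg v$, choosing $q$ such that $y$ is replaced by $y \bmod u$
  makes $v = y^2/u$ smaller than $u$; the reflection $x \mapsto -x$ exchanges $u$ and $v$. This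
  Euclidean algorithm ends at $u = 0$, where the triple is $(x,0,x)$ with $x$ a unit by
  primitivity, and scaling $v$ by $x^{-1}$ and $u$ by $x$ leads to $(1,0,1)$.
\<close>

section \<open>The orthogonal group and its action\<close>

lemma carrier_orthogonal_grp:
  "A \<in> carrier orthogonal_grp \<longleftrightarrow> invertible A \<and> (\<forall>x. quadform (A *v x) = quadform x)"
  by (simp add: orthogonal_grp_def)

lemma mult_orthogonal_grp: "A \<otimes>\<^bsub>orthogonal_grp\<^esub> B = A ** B"
  by (simp add: orthogonal_grp_def)

lemma one_orthogonal_grp: "\<one>\<^bsub>orthogonal_grp\<^esub> = mat 1"
  by (simp add: orthogonal_grp_def)

lemma orthogonal_grp_memI:
  assumes "A ** B = mat 1" "B ** A = mat 1" "\<And>x. quadform (A *v x) = quadform x"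
  shows "A \<in> carrier orthogonal_grp"
  using assms unfolding carrier_orthogonal_grp invertible_def by blast

lemma orthogonal_grp_inverse:
  assumes "A \<in> carrier orthogonal_grp"
  obtains B where "B \<in> carrier orthogonal_grp" "A ** B = mat 1" "B ** A = mat 1"
proof -
  obtain B where B: "A ** B = mat 1" "B ** A = mat 1"
    using assms unfolding carrier_orthogonal_grp invertible_def by blast
  have "quadform (B *v x) = quadform x" for x
  proof -
    have "quadform (B *v x) = quadform (A *v (B *v x))"
      using assms by (simp add: carrier_orthogonal_grp)
    also have "\<dots> = quadform x"
      by (simp add: matrix_vector_mul_assoc B)
    finally show ?thesis .
  qed
  with B that show thesis
    by (meson orthogonal_grp_memI)
qed

lemma orthogonal_grp_mult_closed:
  assumes "A \<in> carrier orthogonal_grp" "B \<in> carrier orthogonal_grp"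
  shows "A ** B \<in> carrier orthogonal_grp"
  using assms
  by (simp add: carrier_orthogonal_grp invertible_mult flip: matrix_vector_mul_assoc)

lemma mat_1_in_orthogonal_grp: "mat 1 \<in> carrier orthogonal_grp"
  by (rule orthogonal_grp_memI[of _ "mat 1"]) simp_all

lemma group_orthogonal_grp: "group orthogonal_grp"
proof (rule groupI, unfold mult_orthogonal_grp one_orthogonal_grp)
  show "\<exists>B\<in>carrier orthogonal_grp. B ** A = mat 1" if "A \<in> carrier orthogonal_grp" for A
    using orthogonal_grp_inverse[OF that] by blast
qed (simp_all add: orthogonal_grp_mult_closed mat_1_in_orthogonal_grp matrix_mul_assoc)

lemma dvd_matrix_vector_mult:
  fixes A :: "'r::comm_ring_1 ^ 'n ^ 'm"
  assumes "\<And>i. d dvd v $ i"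
  shows "d dvd (A *v v) $ j"
  using assms by (auto simp: matrix_vector_mult_def intro!: dvd_sum)

text \<open>A common divisor of the entries of \<open>A *v v\<close> also divides those of
  \<open>B *v (A *v v)\<close>, which is \<open>v\<close> for the inverse \<open>B\<close>.\<close>

lemma primitive_matrix_vector_mult:
  assumes "invertible A" "primitive v"
  shows "primitive (A *v v)"
proof -
  obtain B where "B ** A = mat 1"
    using assms(1) unfolding invertible_def by blast
  then have v: "v = B *v (A *v v)"
    by (simp add: matrix_vector_mul_assoc)
  have "is_unit d" if "\<forall>i. d dvd (A *v v) $ i" for d
  proof -
    have "d dvd v $ j" for j
      using that by (subst v) (blast intro: dvd_matrix_vector_mult)
    then show ?thesis
      using assms(2) by (simp add: primitive_def)
  qed
  then show ?thesis
    by (simp add: primitive_def forall_3)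
qed

text \<open>In this form stability under the group is immediate: orthogonality preserves the first
  condition, invertibility the second.\<close>

lemma primitive_pythagorean_triples_iff:
  "v \<in> primitive_pythagorean_triples \<longleftrightarrow> quadform v = 0 \<and> primitive v"
proof -
  have "\<not> primitive (0 :: 'a poly ^ 3)"
    by (auto simp: primitive_def intro: exI[of _ 0])
  then show ?thesis
    by (auto simp: primitive_pythagorean_triples_def pythagorean_triple_def quadform_def)
qed

lemma orthogonal_grp_preserves_triples:
  assumes "A \<in> carrier orthogonal_grp" "v \<in> primitive_pythagorean_triples"
  shows "A *v v \<in> primitive_pythagorean_triples"
  using assms
  by (simp add: carrier_orthogonal_grp primitive_pythagorean_triples_iff
      primitive_matrix_vector_mult)

text \<open>\<open>BijGroup\<close> consists of extensional bijections, so multiplication by a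
  matrix is restricted to the set of triples.\<close>

lemma group_action_triples:
  "group_action orthogonal_grp (primitive_pythagorean_triples :: ('a::field poly ^ 3) set)
     (\<lambda>A. \<lambda>v\<in>primitive_pythagorean_triples. A *v v)"
  (is "group_action _ ?T ?act")
proof -
  have bij: "?act A \<in> Bij ?T" if A: "A \<in> carrier orthogonal_grp" for A
  proof -
    obtain B where B: "B \<in> carrier orthogonal_grp" "A ** B = mat 1" "B ** A = mat 1"
      using orthogonal_grp_inverse[OF A] .
    have "bij_betw ((*v) A) ?T ?T"
      by (rule bij_betw_byWitness[where f' = "(*v) B"])
        (auto simp: matrix_vector_mul_assoc B orthogonal_grp_preserves_triples A)
    then show ?thesis
      by (simp add: Bij_def cong: bij_betw_cong)
  qed
  have "?act \<in> hom orthogonal_grp (BijGroup ?T)"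
  proof (rule homI)
    fix A B :: "'a poly ^ 3 ^ 3"
    assume A: "A \<in> carrier orthogonal_grp" and B: "B \<in> carrier orthogonal_grp"
    show "?act (A \<otimes>\<^bsub>orthogonal_grp\<^esub> B) = ?act A \<otimes>\<^bsub>BijGroup ?T\<^esub> ?act B"
      using bij[OF A] bij[OF B]
      by (auto simp: BijGroup_def compose_def fun_eq_iff mult_orthogonal_grp
          orthogonal_grp_preserves_triples[OF B] matrix_vector_mul_assoc)
  qed (simp add: BijGroup_def bij)
  then show ?thesis
    by (simp add: group_action_def group_hom_def group_hom_axioms_def
        group_orthogonal_grp group_BijGroup)
qed

section \<open>Elementary orthogonal matrices\<close>

lemmas matrix_3_simps =
  vec_eq_iff forall_3 sum_3 matrix_matrix_mult_def matrix_vector_mult_def mat_def quadform_def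

definition reflection :: "'r::comm_ring_1 ^ 3 ^ 3" where
  "reflection = vector [vector [-1, 0, 0], vector [0, 1, 0], vector [0, 0, 1]]"

lemma reflection_in_orthogonal_grp: "reflection \<in> carrier orthogonal_grp"
  by (rule orthogonal_grp_memI[of _ reflection]) (simp_all add: reflection_def matrix_3_simps)

text \<open>With \<open>h = q\<^sup>2 / 2\<close> this is the map \<open>y \<mapsto> y + qu\<close>, \<open>v \<mapsto> v + 2qy + q\<^sup>2u\<close>.\<close>
definition shear :: "'r::comm_ring_1 \<Rightarrow> 'r \<Rightarrow> 'r ^ 3 ^ 3" where
  "shear q h = vector [vector [1 - h, q, h], vector [- q, 1, q], vector [- h, q, 1 + h]]"

text \<open>The parameter \<open>h\<close> avoids halving in a general commutative ring. The inverse
  only flips the sign of \<open>q\<close>.\<close>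

lemma shear_in_orthogonal_grp:
  assumes "2 * h = q\<^sup>2"
  shows "shear q h \<in> carrier orthogonal_grp"
proof (rule orthogonal_grp_memI[of _ "shear (- q) h"])
  have h: "q * q = h + h"
    using assms by (metis power2_eq_square mult_2)
  show "shear q h ** shear (- q) h = mat 1" "shear (- q) h ** shear q h = mat 1"
    by (simp_all add: shear_def matrix_3_simps algebra_simps h)
  show "quadform (shear q h *v x) = quadform x" for x
  proof -
    have "((1 - h) * a + q * b + h * c)\<^sup>2 + (- q * a + b + q * c)\<^sup>2
        - (- h * a + q * b + (1 + h) * c)\<^sup>2
      = a\<^sup>2 + b\<^sup>2 - c\<^sup>2 + (q\<^sup>2 - 2 * h) * (c - a)\<^sup>2" for a b c
      by (simp add: power2_eq_square algebra_simps)
    from this[of "x $ 1" "x $ 2" "x $ 3"] show ?thesis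
      by (simp add: assms shear_def matrix_3_simps)
  qed
qed

text \<open>This multiplies \<open>z - x\<close> by \<open>p - r\<close> and \<open>z + x\<close> by \<open>p + r\<close>.\<close>
definition scaling :: "'r::comm_ring_1 \<Rightarrow> 'r \<Rightarrow> 'r ^ 3 ^ 3" where
  "scaling p r = vector [vector [p, 0, r], vector [0, 1, 0], vector [r, 0, p]]"

text \<open>The assumption says \<open>(p - r) * (p + r) = 1\<close>: the factors applied to z - x
  and z + x are mutually inverse, so the product of these two coordinates is preserved.\<close>

lemma scaling_in_orthogonal_grp:
  assumes "p\<^sup>2 - r\<^sup>2 = 1"
  shows "scaling p r \<in> carrier orthogonal_grp"
proof (rule orthogonal_grp_memI[of _ "scaling p (- r)"])
  have "p * p = 1 + r * r"
    using assms by (simp add: power2_eq_square algebra_simps)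
  then show "scaling p r ** scaling p (- r) = mat 1" "scaling p (- r) ** scaling p r = mat 1"
    by (simp_all add: scaling_def matrix_3_simps algebra_simps)
  show "quadform (scaling p r *v x) = quadform x" for x
  proof -
    have "(p * a + r * c)\<^sup>2 + b\<^sup>2 - (r * a + p * c)\<^sup>2 = (p\<^sup>2 - r\<^sup>2) * (a\<^sup>2 - c\<^sup>2) + b\<^sup>2" for a b c
      by (simp add: power2_eq_square algebra_simps)
    from this[of "x $ 1" "x $ 3" "x $ 2"] show ?thesis
      by (simp add: assms scaling_def matrix_3_simps)
  qed
qed

section \<open>The Euclidean algorithm\<close>

lemma two_neq_0_if_CHAR_neq_2:
  assumes "CHAR('a::field) \<noteq> 2"
  shows "(2 :: 'a) \<noteq> 0"
proof
  assume "(2 :: 'a) = 0"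
  then have "CHAR('a) dvd 2"
    using of_nat_eq_0_iff_char_dvd[where ?'a = 'a, of 2] by simp
  then have "CHAR('a) \<le> 2" "CHAR('a) \<noteq> 0"
    by (auto dest: dvd_imp_le intro: gr0I)
  then show False
    using assms CHAR_not_1'[where ?'a = 'a] by linarith
qed

lemma orbit_of_1_0_1:
  fixes v :: "'a::field poly ^ 3"
  assumes char: "CHAR('a) \<noteq> 2" and "v \<in> primitive_pythagorean_triples"
  shows "\<exists>A\<in>carrier orthogonal_grp. A *v v = vector [1, 0, 1]"
  using assms(2)
\<comment> \<open>The measure is symmetric in z - x and z + x, hence unchanged by the
  reflection.\<close>
proof (induction "euclidean_size (v $ 3 - v $ 1) + euclidean_size (v $ 3 + v $ 1)"
    arbitrary: v rule: less_induct)
  case less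
  \<comment> \<open>The constant polynomial 1/2; this is where the characteristic enters.\<close>
  define w :: "'a poly" where "w = [:1 / 2:]"
  have w: "2 * w = 1"
    using two_neq_0_if_CHAR_neq_2[OF char] by (simp add: w_def numeral_poly one_pCons)
  let ?P = "\<lambda>v :: 'a poly ^ 3. \<exists>A\<in>carrier orthogonal_grp. A *v v = vector [1, 0, 1]"
  have pull_back: "?P x" if "A \<in> carrier orthogonal_grp" "?P (A *v x)" for A x
    using that by (metis matrix_vector_mul_assoc orthogonal_grp_mult_closed)
  \<comment> \<open>Stated for any triple of the same measure as \<open>v\<close>, so that it serves
    both \<open>v\<close> and its reflection.\<close>
  have reduce: "?P x"
    if x: "x \<in> primitive_pythagorean_triples"
      and le: "euclidean_size (x $ 3 - x $ 1) \<le> euclidean_size (x $ 3 + x $ 1)"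
      and size: "euclidean_size (x $ 3 - x $ 1) + euclidean_size (x $ 3 + x $ 1) =
        euclidean_size (v $ 3 - v $ 1) + euclidean_size (v $ 3 + v $ 1)" for x
  proof (cases "x $ 3 - x $ 1 = 0")
    case True
    then have x3: "x $ 3 = x $ 1" by simp
    with x have x2: "x $ 2 = 0"
      by (simp add: primitive_pythagorean_triples_iff quadform_def)
    have "is_unit (x $ 1)"
      using x x2 x3 by (simp add: primitive_pythagorean_triples_iff primitive_def)
    then obtain b where b: "x $ 1 * b = 1"
      by (metis dvdE)
    \<comment> \<open>These solve p + r = b and p - r = x $ 1, which are inverse to each
      other.\<close>
    define p r where "p = w * (x $ 1 + b)" and "r = w * (b - x $ 1)"
    have pr: "p\<^sup>2 - r\<^sup>2 = 1" "p + r = b"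
      using b w unfolding p_def r_def by algebra+
    have "(p + r) * x $ 1 = 1"
      using b by (simp add: pr mult.commute)
    then have "scaling p r *v x = vector [1, 0, 1]"
      by (simp add: scaling_def matrix_3_simps x2 x3 algebra_simps)
    then show ?thesis
      using scaling_in_orthogonal_grp[OF pr(1)] by blast
  next
    case False
    define u where "u = x $ 3 - x $ 1"
    define q where "q = - (x $ 2 div u)"
    define S where "S = shear q (w * q\<^sup>2)"
    define y where "y = S *v x"
    have "2 * (w * q\<^sup>2) = q\<^sup>2"
      using w by algebra
    then have S: "S \<in> carrier orthogonal_grp"
      unfolding S_def by (rule shear_in_orthogonal_grp)
    have y: "y \<in> primitive_pythagorean_triples"
      unfolding y_def using S x by (rule orthogonal_grp_preserves_triples)
    have y_diff: "y $ 3 - y $ 1 = u"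
      by (simp add: y_def S_def shear_def matrix_3_simps u_def algebra_simps)
    have "y $ 2 = x $ 2 - x $ 2 div u * u"
      by (simp add: y_def S_def shear_def matrix_3_simps u_def q_def algebra_simps)
    then have y2: "y $ 2 = x $ 2 mod u"
      by (simp add: minus_div_mult_eq_mod)
    let ?s = "euclidean_size :: 'a poly \<Rightarrow> nat"
    have s2: "?s (y $ 2) < ?s u"
      unfolding y2 using False by (simp add: u_def mod_size_less)
    have "u * (y $ 3 + y $ 1) = y $ 2 * y $ 2"
      using y unfolding y_diff[symmetric] primitive_pythagorean_triples_iff quadform_def
      by algebra
    \<comment> \<open>\<open>euclidean_size\<close> is multiplicative and vanishes at 0, so the
      estimate also covers a zero remainder.\<close>
    then have "?s u * ?s (y $ 3 + y $ 1) = ?s (y $ 2) * ?s (y $ 2)"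
      by (metis euclidean_size_mult)
    also have "\<dots> < ?s u * ?s u"
      using s2 by (intro mult_strict_mono) auto
    finally have "?s (y $ 3 + y $ 1) < ?s u"
      by simp
    \<comment> \<open>The shear keeps \<open>u\<close>, and the new z + x is smaller than
      \<open>u\<close>, hence smaller than the old z + x by \<open>le\<close>: the measure
      drops.\<close>
    then have "?P y"
      using le size y by (intro less.hyps) (auto simp: y_diff u_def)
    then show ?thesis
      using pull_back[OF S] unfolding y_def by blast
  qed
  show "?P v"
  proof (cases "euclidean_size (v $ 3 - v $ 1) \<le> euclidean_size (v $ 3 + v $ 1)")
    case True
    then show ?thesis
      using less.prems by (intro reduce) auto
  next
    case False
    define x where "x = reflection *v v"
    have "x $ 1 = - v $ 1" "x $ 3 = v $ 3"
      by (simp_all add: x_def reflection_def matrix_3_simps)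
    moreover have "x \<in> primitive_pythagorean_triples"
      unfolding x_def using reflection_in_orthogonal_grp less.prems
      by (rule orthogonal_grp_preserves_triples)
    ultimately have "?P x"
      using False by (intro reduce) auto
    then show ?thesis
      using pull_back[OF reflection_in_orthogonal_grp] unfolding x_def by blast
  qed
qed

theorem theorem1p3:
  assumes "CHAR('a::field) \<noteq> 2"
  shows "transitive_action
           (orthogonal_grp :: ('a poly ^ 3 ^ 3) monoid)
           (primitive_pythagorean_triples :: ('a poly ^ 3) set)
           (\<lambda>A. \<lambda>v\<in>primitive_pythagorean_triples. A *v v)"
proof (intro transitive_action.intro group_action_triples transitive_action_axioms.intro)
  fix x y :: "'a poly ^ 3"
  assume x: "x \<in> primitive_pythagorean_triples" and y: "y \<in> primitive_pythagorean_triples"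
  obtain A where A: "A \<in> carrier orthogonal_grp" "A *v x = vector [1, 0, 1]"
    using orbit_of_1_0_1[OF assms x] by blast
  obtain B where B: "B \<in> carrier orthogonal_grp" "B *v y = vector [1, 0, 1]"
    using orbit_of_1_0_1[OF assms y] by blast
  \<comment> \<open>The path from \<open>x\<close> to \<open>y\<close> passes through (1,0,1): first
    \<open>A\<close>, then the inverse of \<open>B\<close>.\<close>
  obtain C where C: "C \<in> carrier orthogonal_grp" "C ** B = mat 1"
    using orthogonal_grp_inverse[OF B(1)] by blast
  have "(C ** A) *v x = C *v (B *v y)"
    by (simp add: A B flip: matrix_vector_mul_assoc)
  also have "\<dots> = y"
    by (simp add: matrix_vector_mul_assoc C)
  finally show "\<exists>g\<in>carrier orthogonal_grp. (\<lambda>v\<in>primitive_pythagorean_triples. g *v v) x = y"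
    using orthogonal_grp_mult_closed[OF C(1) A(1)] x by auto
qed

end
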